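(* Let $X$ be a discrete random variable taking $M\ge2$ possible values ($M<\infty$), and let $Y$ be a random variable jointly distributed with $X$. Then $$\varepsilon_{X|Y}\ge\Bigl(1-\frac1M\Bigr)\frac{1}{\xi_1}\left(1-\sqrt{\frac{\xi_1-1}{M-1}}\right)^2,$$ $$\varepsilon_{X|Y}\ge\Bigl(1-\frac1M\Bigr)\left(1-\sqrt{\frac{\xi_2-1}{M-1}}\right),$$ where $$\xi_1=M\exp\bigl(-H_{\frac12}(X|Y)\bigr),\qquad \xi_2=M\exp\bigl(-H_2(X|Y)\bigr).$$
   Context: Logarithms have an arbitrary fixed base larger than 1 and $\exp$ is the inverse of $\log$. $X$ takes values in a finite set $\mathcal{X}$ with $|\mathcal{X}|=M$, and $Y$ takes values in an arbitrary observation space $\mathcal{Y}$. The Arimoto-R\'enyi conditional entropy of order $\alpha\in(0,1)\cup(1,\infty)$ is $$H_\alpha(X|Y)=\frac{\alpha}{1-\alpha}\log\mathbb{E}\left[\Bigl(\sum_{x\in\mathcal{X}}P_{X|Y}^\alpha(x|Y)\Bigr)^{1/\alpha}\right],$$ the expectation being over $Y\sim P_Y$. The minimum error probability of guessing $X$ from $Y$ is $\varepsilon_{X|Y}=\min_{\mathcal{L}\colon\mathcal{Y}\to\mathcal{X}}\mathbb{P}[X\ne\mathcal{L}(Y)]=1-\mathbb{E}[\max_{x\in\mathcal{X}}P_{X|Y}(x|Y)]$. *)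

theory Defs
  imports "HOL-Probability.Probability"
begin

text \<open>
  Here \<open>P\<close> is the underlying probability measure, \<open>X\<close> takes values in a finite set \<open>A\<close> and
  \<open>Y\<close> in an arbitrary measurable space \<open>N\<close>.
\<close>

text \<open>
  The conditional probability of \<open>X = x\<close> given \<open>Y = y\<close>: the density of
  \<open>B \<mapsto> Pr(X = x, Y \<in> B)\<close> with respect to the law of \<open>Y\<close>. It is determined up to a null set of
  the law of \<open>Y\<close> (see \<open>set_nn_integral_posterior\<close> below).
\<close>

definition posterior ::
  "'w measure \<Rightarrow> ('w \<Rightarrow> 'a) \<Rightarrow> 'b measure \<Rightarrow> ('w \<Rightarrow> 'b) \<Rightarrow> 'a \<Rightarrow> 'b \<Rightarrow> real" where
  "posterior P X N Y x y =
     enn2real (RN_deriv (distr P N Y)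
       (distr (density P (indicator (X -` {x} \<inter> space P))) N Y) y)"

definition arimoto_renyi ::
  "real \<Rightarrow> real \<Rightarrow> 'w measure \<Rightarrow> 'a set \<Rightarrow> ('w \<Rightarrow> 'a) \<Rightarrow> 'b measure \<Rightarrow> ('w \<Rightarrow> 'b) \<Rightarrow> real" where
  "arimoto_renyi b \<alpha> P A X N Y =
     \<alpha> / (1 - \<alpha>) *
       log b (\<integral>y. (\<Sum>x\<in>A. posterior P X N Y x y powr \<alpha>) powr (1 / \<alpha>) \<partial>distr P N Y)"

text \<open>
  The infimum is over measurable decision rules and is attained
  (\<open>min_error_prob_attained\<close> below).
\<close>

definition min_error_prob ::
  "'w measure \<Rightarrow> 'a set \<Rightarrow> ('w \<Rightarrow> 'a) \<Rightarrow> 'b measure \<Rightarrow> ('w \<Rightarrow> 'b) \<Rightarrow> real" where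
  "min_error_prob P A X N Y =
     (INF L \<in> measurable N (count_space A).
        measure P {\<omega> \<in> space P. X \<omega> \<noteq> L (Y \<omega>)})"

context
  fixes P :: "'w measure" and A :: "'a set" and X :: "'w \<Rightarrow> 'a"
    and N :: "'b measure" and Y :: "'w \<Rightarrow> 'b"
  assumes P: "prob_space P" and A: "finite A"
    and X: "X \<in> measurable P (count_space A)" and Y: "Y \<in> measurable P N"
begin

lemma borel_measurable_posterior [measurable]:
  "posterior P X N Y x \<in> borel_measurable N"
proof -
  have "RN_deriv (distr P N Y) (distr (density P (indicator (X -` {x} \<inter> space P))) N Y)
     \<in> borel_measurable N"
    using borel_measurable_RN_deriv[of "distr P N Y"] by simp
  then show ?thesis unfolding posterior_def[abs_def] by measurable
qed

lemma set_nn_integral_posterior: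
  assumes x: "x \<in> A" and B: "B \<in> sets N"
  shows "(\<integral>\<^sup>+y\<in>B. ennreal (posterior P X N Y x y) \<partial>distr P N Y) =
           ennreal (measure P {\<omega> \<in> space P. X \<omega> = x \<and> Y \<omega> \<in> B})"
proof -
  note Y[measurable]
  interpret P: prob_space P by (rule P)
  interpret D: prob_space "distr P N Y" by (rule P.prob_space_distr[OF Y])
  let ?E = "X -` {x} \<inter> space P"
  have E[measurable]: "?E \<in> sets P"
    by (rule measurable_sets[OF X]) (use x in simp)
  let ?J = "distr (density P (indicator ?E)) N Y"
  have em: "emeasure ?J C = emeasure P (?E \<inter> (Y -` C \<inter> space P))" if C[measurable]: "C \<in> sets N" for C
  proof -
    have S: "Y -` C \<inter> space P \<in> sets P" by measurable
    have "emeasure ?J C = emeasure (density P (indicator ?E)) (Y -` C \<inter> space P)"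
      by (subst emeasure_distr) auto
    also have "\<dots> = (\<integral>\<^sup>+\<omega>. indicator ?E \<omega> * indicator (Y -` C \<inter> space P) \<omega> \<partial>P)"
      by (rule emeasure_density) (use S in auto)
    also have "\<dots> = (\<integral>\<^sup>+\<omega>. indicator (?E \<inter> (Y -` C \<inter> space P)) \<omega> \<partial>P)"
      by (intro nn_integral_cong) (auto simp: indicator_def)
    also have "\<dots> = emeasure P (?E \<inter> (Y -` C \<inter> space P))"
      by (rule nn_integral_indicator) (use E S in auto)
    finally show ?thesis .
  qed
  have ac: "absolutely_continuous (distr P N Y) ?J"
    unfolding absolutely_continuous_def
  proof
    fix C assume C: "C \<in> null_sets (distr P N Y)"
    then have CN: "C \<in> sets N" and z: "emeasure P (Y -` C \<inter> space P) = 0"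
      by (auto simp: null_sets_def emeasure_distr)
    have "emeasure P (?E \<inter> (Y -` C \<inter> space P)) \<le> emeasure P (Y -` C \<inter> space P)"
      using CN by (intro emeasure_mono) auto
    then show "C \<in> null_sets ?J" using CN z em[OF CN] by (auto simp: null_sets_def)
  qed
  interpret J: finite_measure ?J
  proof
    have "emeasure ?J (space N) \<le> emeasure P (space P)"
      by (subst em) (auto intro!: emeasure_mono)
    then show "emeasure ?J (space ?J) \<noteq> \<infinity>"
      using P.emeasure_space_1 by (auto simp: top_unique)
  qed
  have fin: "AE y in distr P N Y. RN_deriv (distr P N Y) ?J y \<noteq> \<infinity>"
    by (rule D.RN_deriv_finite[OF _ ac]) (auto intro: J.sigma_finite_measure_axioms)
  have "(\<integral>\<^sup>+y\<in>B. ennreal (posterior P X N Y x y) \<partial>distr P N Y) =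
        (\<integral>\<^sup>+y\<in>B. RN_deriv (distr P N Y) ?J y \<partial>distr P N Y)"
    by (rule nn_integral_cong_AE, use fin in eventually_elim)
       (simp add: posterior_def ennreal_enn2real_if)
  also have "\<dots> = emeasure (density (distr P N Y) (RN_deriv (distr P N Y) ?J)) B"
    by (rule emeasure_density[symmetric]) (use B in auto)
  also have "\<dots> = emeasure ?J B"
    by (subst D.density_RN_deriv[OF ac]) auto
  also have "\<dots> = emeasure P {\<omega> \<in> space P. X \<omega> = x \<and> Y \<omega> \<in> B}"
    by (subst em[OF B]) (auto intro!: arg_cong[where f = "emeasure P"])
  finally show ?thesis by (simp add: P.emeasure_eq_measure)
qed

lemma min_error_prob_attained:
  assumes ne: "A \<noteq> {}"
  shows "\<exists>L \<in> measurable N (count_space A).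
    min_error_prob P A X N Y = measure P {\<omega> \<in> space P. X \<omega> \<noteq> L (Y \<omega>)}"
    and "min_error_prob P A X N Y = 1 - (\<integral>y. (MAX x\<in>A. posterior P X N Y x y) \<partial>distr P N Y)"
proof -
  note Y[measurable]
  interpret P: prob_space P by (rule P)
  interpret D: prob_space "distr P N Y" by (rule P.prob_space_distr[OF Y])
  let ?p = "posterior P X N Y" and ?D = "distr P N Y"
  have p0: "?p x y \<ge> 0" for x y by (simp add: posterior_def)
  have int: "integrable ?D (\<lambda>y. indicator B y * ?p x y)"
    and val: "(\<integral>y. indicator B y * ?p x y \<partial>?D) = measure P {\<omega> \<in> space P. X \<omega> = x \<and> Y \<omega> \<in> B}"
    if "x \<in> A" and B[measurable]: "B \<in> sets N" for x B
  proof -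
    have "(\<integral>\<^sup>+y. ennreal (indicator B y * ?p x y) \<partial>?D) =
        (\<integral>\<^sup>+y\<in>B. ennreal (?p x y) \<partial>?D)"
      by (intro nn_integral_cong) (auto simp: indicator_def)
    also have "\<dots> = ennreal (measure P {\<omega> \<in> space P. X \<omega> = x \<and> Y \<omega> \<in> B})"
      by (rule set_nn_integral_posterior) fact+
    finally have *: "(\<integral>\<^sup>+y. ennreal (indicator B y * ?p x y) \<partial>?D) =
       ennreal (measure P {\<omega> \<in> space P. X \<omega> = x \<and> Y \<omega> \<in> B})" .
    show "integrable ?D (\<lambda>y. indicator B y * ?p x y)"
      by (rule integrableI_nn_integral_finite[OF _ _ *]) (auto simp: p0)
    show "(\<integral>y. indicator B y * ?p x y \<partial>?D) = measure P {\<omega> \<in> space P. X \<omega> = x \<and> Y \<omega> \<in> B}"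
      by (rule integral_eq_nn_integral[THEN trans]) (auto simp: p0 *)
  qed
  have intx: "integrable ?D (?p x)" if "x \<in> A" for x
  proof -
    have "integrable ?D (\<lambda>y. indicator (space N) y * ?p x y)"
      using that by (intro int) auto
    then show ?thesis
      by (rule Bochner_Integration.integrable_cong[THEN iffD1, rotated 2]) auto
  qed
  have intM: "integrable ?D (\<lambda>y. MAX x\<in>A. ?p x y)"
    using integrable_MAX[OF A ne, of ?D ?p] intx by simp
  have err: "measure P {\<omega> \<in> space P. X \<omega> \<noteq> L (Y \<omega>)} = 1 - (\<integral>y. ?p (L y) y \<partial>?D)
      \<and> integrable ?D (\<lambda>y. ?p (L y) y)"
    if L[measurable]: "L \<in> measurable N (count_space A)" for L
  proof -
    let ?B = "\<lambda>x. L -` {x} \<inter> space N"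
    have B: "?B x \<in> sets N" if "x \<in> A" for x
      using measurable_sets[OF L, of "{x}"] that by auto
    have LA: "L y \<in> A" if "y \<in> space N" for y
      using measurable_space[OF L that] by simp
    have YN: "Y \<omega> \<in> space N" if "\<omega> \<in> space P" for \<omega> using measurable_space[OF Y that] .
    have XE: "{\<omega> \<in> space P. X \<omega> = x \<and> Y \<omega> \<in> ?B x} \<in> sets P" if "x \<in> A" for x
    proof -
      have "X -` {x} \<inter> space P \<in> sets P" "Y -` ?B x \<inter> space P \<in> sets P"
        using measurable_sets[OF X, of "{x}"] measurable_sets[OF Y B[OF that]] that by auto
      then have "(X -` {x} \<inter> space P) \<inter> (Y -` ?B x \<inter> space P) \<in> sets P" by blast
      then show ?thesis by (rule back_subst[where P = "\<lambda>S. S \<in> sets P"]) auto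
    qed
    have eq: "?p (L y) y = (\<Sum>x\<in>A. indicator (?B x) y * ?p x y)" if "y \<in> space N" for y
    proof -
      have "(\<Sum>x\<in>A. indicator (?B x) y * ?p x y) = (\<Sum>x\<in>A. if x = L y then ?p x y else 0)"
        by (rule sum.cong) (use that in \<open>auto simp: indicator_def\<close>)
      then show ?thesis using A LA[OF that] by simp
    qed
    have i: "integrable ?D (\<lambda>y. \<Sum>x\<in>A. indicator (?B x) y * ?p x y)"
      by (intro Bochner_Integration.integrable_sum int B)
    have i': "integrable ?D (\<lambda>y. ?p (L y) y)"
      using i by (rule Bochner_Integration.integrable_cong[THEN iffD1, rotated 2]) (auto simp: eq)
    have "(\<integral>y. ?p (L y) y \<partial>?D) = (\<integral>y. (\<Sum>x\<in>A. indicator (?B x) y * ?p x y) \<partial>?D)"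
      by (rule Bochner_Integration.integral_cong) (auto simp: eq)
    also have "\<dots> = (\<Sum>x\<in>A. measure P {\<omega> \<in> space P. X \<omega> = x \<and> Y \<omega> \<in> ?B x})"
    proof (subst Bochner_Integration.integral_sum)
      show "integrable ?D (\<lambda>y. indicator (?B x) y * ?p x y)" if "x \<in> A" for x
        by (rule int[OF that B[OF that]])
      show "(\<Sum>x\<in>A. \<integral>y. indicator (?B x) y * ?p x y \<partial>?D) =
          (\<Sum>x\<in>A. measure P {\<omega> \<in> space P. X \<omega> = x \<and> Y \<omega> \<in> ?B x})"
        by (rule sum.cong[OF refl]) (rule val[OF _ B])
    qed
    also have "\<dots> = measure P (\<Union>x\<in>A. {\<omega> \<in> space P. X \<omega> = x \<and> Y \<omega> \<in> ?B x})"
      by (rule P.finite_measure_finite_Union[symmetric])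
         (use A XE in \<open>auto simp: disjoint_family_on_def\<close>)
    also have "(\<Union>x\<in>A. {\<omega> \<in> space P. X \<omega> = x \<and> Y \<omega> \<in> ?B x}) = {\<omega> \<in> space P. X \<omega> = L (Y \<omega>)}"
      using YN LA by auto
    finally have c: "(\<integral>y. ?p (L y) y \<partial>?D) = measure P {\<omega> \<in> space P. X \<omega> = L (Y \<omega>)}" .
    have "(\<Union>x\<in>A. {\<omega> \<in> space P. X \<omega> = x \<and> Y \<omega> \<in> ?B x}) \<in> sets P"
      by (rule sets.finite_UN[OF A XE])
    also have "(\<Union>x\<in>A. {\<omega> \<in> space P. X \<omega> = x \<and> Y \<omega> \<in> ?B x}) = {\<omega> \<in> space P. X \<omega> = L (Y \<omega>)}"
      using YN LA by auto
    finally have "measure P (space P - {\<omega> \<in> space P. X \<omega> = L (Y \<omega>)}) =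
        1 - measure P {\<omega> \<in> space P. X \<omega> = L (Y \<omega>)}"
      by (rule P.prob_compl)
    moreover have "space P - {\<omega> \<in> space P. X \<omega> = L (Y \<omega>)} = {\<omega> \<in> space P. X \<omega> \<noteq> L (Y \<omega>)}"
      by auto
    ultimately show ?thesis using c i' by simp
  qed
  obtain xs where xs: "set xs = A" "distinct xs" using finite_distinct_list[OF A] by blast
  have "\<exists>L \<in> measurable N (count_space A). \<forall>y. \<forall>x\<in>set zs. ?p x y \<le> ?p (L y) y"
    if "set zs \<subseteq> A" for zs using that
  proof (induction zs)
    case Nil
    from ne obtain a where "a \<in> A" by blast
    then have "(\<lambda>_. a) \<in> measurable N (count_space A)" by simp
    then show ?case by (intro bexI[where x = "\<lambda>_. a"]) simp_all
  next
    case (Cons z zs)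
    from Cons.prems have "set zs \<subseteq> A" by simp
    from Cons.IH[OF this] obtain L where L: "L \<in> measurable N (count_space A)"
      and m: "\<And>y x. x \<in> set zs \<Longrightarrow> ?p x y \<le> ?p (L y) y" by blast
    have z: "z \<in> A" using Cons.prems by simp
    have pL: "(\<lambda>y. ?p (L y) y) \<in> borel_measurable N"
      using borel_measurable_integrable[OF conjunct2[OF err[OF L]]] by simp
    have "{y \<in> space N. ?p (L y) y < ?p z y} \<in> sets N"
      by (rule borel_measurable_less[OF pL borel_measurable_posterior])
    then have mem: "(\<lambda>y. if ?p (L y) y < ?p z y then z else L y) \<in> measurable N (count_space A)"
      by (intro measurable_If[OF _ L]) (simp_all add: z)
    have all: "\<forall>y. \<forall>x\<in>set (z # zs). ?p x y \<le>
        ?p (if ?p (L y) y < ?p z y then z else L y) y"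
    proof (intro allI ballI)
      fix y x assume "x \<in> set (z # zs)"
      then have "x = z \<or> ?p x y \<le> ?p (L y) y" using m by auto
      then show "?p x y \<le> ?p (if ?p (L y) y < ?p z y then z else L y) y" by (auto split: if_splits)
    qed
    show ?case by (rule bexI[OF _ mem]) (rule all)
  qed
  from this[of xs] obtain L where L: "L \<in> measurable N (count_space A)"
    and m: "\<And>y x. x \<in> A \<Longrightarrow> ?p x y \<le> ?p (L y) y" unfolding xs by blast
  have MX: "(MAX x\<in>A. ?p x y) = ?p (L y) y" if "y \<in> space N" for y
  proof (rule Max_eqI)
    show "finite ((\<lambda>x. ?p x y) ` A)" using A by simp
    show "u \<le> ?p (L y) y" if "u \<in> (\<lambda>x. ?p x y) ` A" for u
      using that m by blast
    show "?p (L y) y \<in> (\<lambda>x. ?p x y) ` A"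
      using measurable_space[OF L that] by simp
  qed
  have eL: "measure P {\<omega> \<in> space P. X \<omega> \<noteq> L (Y \<omega>)} = 1 - (\<integral>y. (MAX x\<in>A. ?p x y) \<partial>?D)"
  proof -
    have "(\<integral>y. (MAX x\<in>A. ?p x y) \<partial>?D) = (\<integral>y. ?p (L y) y \<partial>?D)"
      by (rule Bochner_Integration.integral_cong) (simp_all add: MX)
    then show ?thesis using err[OF L] by simp
  qed
  have le: "measure P {\<omega> \<in> space P. X \<omega> \<noteq> L (Y \<omega>)} \<le> measure P {\<omega> \<in> space P. X \<omega> \<noteq> L' (Y \<omega>)}"
    if L': "L' \<in> measurable N (count_space A)" for L'
  proof -
    have "(\<integral>y. ?p (L' y) y \<partial>?D) \<le> (\<integral>y. ?p (L y) y \<partial>?D)"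
    proof (rule integral_mono)
      fix y assume "y \<in> space ?D"
      then have "L' y \<in> A" using measurable_space[OF L'] by simp
      then show "?p (L' y) y \<le> ?p (L y) y" by (rule m)
    qed (use err[OF L] err[OF L'] in simp_all)
    then show ?thesis using err[OF L] err[OF L'] by simp
  qed
  have eq: "min_error_prob P A X N Y = measure P {\<omega> \<in> space P. X \<omega> \<noteq> L (Y \<omega>)}"
    unfolding min_error_prob_def
  proof (rule cInf_eq_minimum)
    show "measure P {\<omega> \<in> space P. X \<omega> \<noteq> L (Y \<omega>)}
       \<in> (\<lambda>L. measure P {\<omega> \<in> space P. X \<omega> \<noteq> L (Y \<omega>)}) ` measurable N (count_space A)"
      using L by (rule imageI)
    fix u assume "u \<in> (\<lambda>L. measure P {\<omega> \<in> space P. X \<omega> \<noteq> L (Y \<omega>)}) ` measurable N (count_space A)"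
    then show "measure P {\<omega> \<in> space P. X \<omega> \<noteq> L (Y \<omega>)} \<le> u"
      by (elim imageE) (simp only: le)
  qed
  show "\<exists>L \<in> measurable N (count_space A).
    min_error_prob P A X N Y = measure P {\<omega> \<in> space P. X \<omega> \<noteq> L (Y \<omega>)}"
    using eq L by blast
  show "min_error_prob P A X N Y = 1 - (\<integral>y. (MAX x\<in>A. ?p x y) \<partial>?D)"
    using eq eL by simp
qed

end

end

theory Submission
  imports Defs
begin

text \<open>
  With \<open>m = max\<^sub>x P(x|Y)\<close>, the Cauchy-Schwarz inequality on the remaining \<open>M - 1\<close> masses
  bounds the two integrands by functions of \<open>m\<close> alone: \<open>(\<Sum>\<^sub>x \<surd>P(x|Y))\<^sup>2\<close> is at most
  \<open>(\<surd>m + \<surd>((M - 1) (1 - m)))\<^sup>2\<close>, which is concave in \<open>m\<close>, and \<open>(\<Sum>\<^sub>x P(x|Y)\<^sup>2)\<^sup>1\<^sup>/\<^sup>2\<close> is at least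
  the Euclidean norm of \<open>(m, (1 - m) / \<surd>(M - 1))\<close>, which is convex. Since the mean of \<open>m\<close> is
  \<open>1 - \<epsilon>\<close>, Jensen's inequality, here in the form of tangent lines, gives the Fano-type bounds
  \<open>M / \<xi>\<^sub>1 \<le> (\<surd>(1 - \<epsilon>) + \<surd>((M - 1) \<epsilon>))\<^sup>2\<close> and \<open>\<xi>\<^sub>2 / M \<ge> (1 - \<epsilon>)\<^sup>2 + \<epsilon>\<^sup>2 / (M - 1)\<close>.
  Both are then solved for \<open>\<epsilon>\<close>.
\<close>

section \<open>Probability vectors with a prescribed maximum\<close>

lemma sum_sqrt_squared_le:
  fixes p :: "'a \<Rightarrow> real"
  assumes "\<And>x. x \<in> S \<Longrightarrow> p x \<ge> 0"
  shows "(\<Sum>x\<in>S. sqrt (p x))\<^sup>2 \<le> real (card S) * (\<Sum>x\<in>S. p x)"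
proof -
  have "(\<Sum>x\<in>S. sqrt (p x))\<^sup>2 \<le> (\<Sum>x\<in>S. (sqrt (p x))\<^sup>2) * card S"
    by (rule sum_squared_le_sum_of_squares)
  also have "(\<Sum>x\<in>S. (sqrt (p x))\<^sup>2) = (\<Sum>x\<in>S. p x)"
    using assms by (intro sum.cong) auto
  finally show ?thesis by (simp add: mult.commute)
qed

context
  fixes A :: "'a set" and p :: "'a \<Rightarrow> real"
  assumes finite: "finite A" and nonempty: "A \<noteq> {}"
    and nonneg: "\<And>x. p x \<ge> 0" and sum_1: "(\<Sum>x\<in>A. p x) = 1"
begin

text \<open>Splits off a single maximiser, even when the maximum is attained several times, so that
  Cauchy-Schwarz applies to the other \<open>card A - 1\<close> masses of total
  \<open>1 - m\<close>.\<close>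

lemma obtain_Max_mass:
  obtains x where "x \<in> A" "p x = (MAX x\<in>A. p x)" "(\<Sum>y\<in>A - {x}. p y) = 1 - (MAX x\<in>A. p x)"
proof -
  have "(MAX x\<in>A. p x) \<in> p ` A"
    using finite nonempty by (intro Max_in) auto
  then obtain x where x: "x \<in> A" "p x = (MAX x\<in>A. p x)" by auto
  moreover have "(\<Sum>y\<in>A - {x}. p y) = 1 - (MAX x\<in>A. p x)"
    using sum.remove[OF finite x(1), of p] x(2) sum_1 by simp
  ultimately show thesis by (rule that)
qed

lemma mass_le_1: "x \<in> A \<Longrightarrow> p x \<le> 1"
  using member_le_sum[of x A p] finite nonneg sum_1 by simp

lemma Max_mass_bounds: "0 \<le> (MAX x\<in>A. p x)" "(MAX x\<in>A. p x) \<le> 1"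
  by (metis nonneg obtain_Max_mass, metis mass_le_1 obtain_Max_mass)

text \<open>On \<open>[0, 1]\<close> the square root dominates the identity.\<close>

lemma sum_sqrt_mass_ge_1: "(\<Sum>x\<in>A. sqrt (p x)) \<ge> 1"
proof -
  have "p x \<le> sqrt (p x)" if "x \<in> A" for x
    using mass_le_1[OF that] nonneg[of x]
    by (intro real_le_rsqrt) (simp add: power2_eq_square mult_left_le)
  then show ?thesis using sum_mono[of A p "\<lambda>x. sqrt (p x)"] sum_1 by simp
qed

lemma sum_sqrt_mass_squared_le_card: "(\<Sum>x\<in>A. sqrt (p x))\<^sup>2 \<le> real (card A)"
  using sum_sqrt_squared_le[of A p] nonneg sum_1 by simp

lemma sum_squared_mass_le_1: "(\<Sum>x\<in>A. (p x)\<^sup>2) \<le> 1"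
proof -
  have "(p x)\<^sup>2 \<le> p x" if "x \<in> A" for x
    using mass_le_1[OF that] nonneg[of x] by (simp add: power2_eq_square mult_left_le)
  then show ?thesis using sum_mono[of A "\<lambda>x. (p x)\<^sup>2" p] sum_1 by simp
qed

text \<open>The slope parameter \<open>t\<close> enters through \<open>2 \<surd>(m (1 - m)) \<le> t m + (1 - m) / t\<close>.\<close>

lemma sum_sqrt_mass_squared_le:
  assumes t: "t > 0"
  defines "m \<equiv> MAX x\<in>A. p x" and "K \<equiv> real (card A) - 1"
  shows "(\<Sum>x\<in>A. sqrt (p x))\<^sup>2 \<le> m + K * (1 - m) + sqrt K * (t * m + (1 - m) / t)"
proof -
  obtain x where x: "x \<in> A" "p x = m" and rest: "(\<Sum>y\<in>A - {x}. p y) = 1 - m"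
    unfolding m_def by (rule obtain_Max_mass)
  have m: "0 \<le> m" "m \<le> 1" using Max_mass_bounds unfolding m_def by auto
  have cK: "real (card (A - {x})) = K"
    using x finite card_gt_0_iff[of A] by (auto simp: K_def of_nat_diff Suc_leI)
  then have K: "K \<ge> 0" by (metis of_nat_0_le_iff)
  define v where "v = (\<Sum>y\<in>A - {x}. sqrt (p y))"
  have v0: "v \<ge> 0" unfolding v_def by (intro sum_nonneg) (simp add: nonneg)
  have v2: "v\<^sup>2 \<le> K * (1 - m)"
    unfolding v_def using sum_sqrt_squared_le[of "A - {x}" p] nonneg rest cK by simp
  have vle: "v \<le> sqrt K * sqrt (1 - m)"
    using real_le_rsqrt[OF v2] by (simp add: real_sqrt_mult)
  have amgm: "2 * (sqrt m * sqrt (1 - m)) \<le> t * m + (1 - m) / t"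
  proof -
    have "0 \<le> (t * sqrt m - sqrt (1 - m))\<^sup>2 / t" using t by simp
    also have "\<dots> = (t\<^sup>2 * m + (1 - m) - 2 * t * (sqrt m * sqrt (1 - m))) / t"
      using m by (simp add: power2_diff power_mult_distrib)
    also have "\<dots> = t * m + (1 - m) / t - 2 * (sqrt m * sqrt (1 - m))"
      using t by (simp add: field_simps power2_eq_square)
    finally show ?thesis by simp
  qed
  have "(\<Sum>x\<in>A. sqrt (p x)) = sqrt m + v"
    using sum.remove[OF finite x(1), of "\<lambda>x. sqrt (p x)"] x(2) by (simp add: v_def)
  then have "(\<Sum>x\<in>A. sqrt (p x))\<^sup>2 = m + v\<^sup>2 + 2 * (sqrt m * v)"
    using m by (simp add: power2_sum)
  also have "\<dots> \<le> m + K * (1 - m) + 2 * (sqrt m * (sqrt K * sqrt (1 - m)))"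
    using v2 vle m by (intro add_mono mult_left_mono) auto
  also have "\<dots> = m + K * (1 - m) + sqrt K * (2 * (sqrt m * sqrt (1 - m)))" by simp
  also have "\<dots> \<le> m + K * (1 - m) + sqrt K * (t * m + (1 - m) / t)"
    by (intro add_left_mono mult_left_mono amgm) (simp add: K)
  finally show ?thesis .
qed

text \<open>A Euclidean norm dominates its pairing with every unit vector \<open>(c, d)\<close>.
  Keeping \<open>(c, d)\<close> free makes the lower bound affine in \<open>m\<close>, so that it
  can be integrated.\<close>

lemma norm_mass_ge:
  assumes cd: "c\<^sup>2 + d\<^sup>2 = 1" and card: "card A \<ge> 2"
  defines "m \<equiv> MAX x\<in>A. p x" and "K \<equiv> real (card A) - 1"
  shows "c * m + d * ((1 - m) / sqrt K) \<le> sqrt (\<Sum>x\<in>A. (p x)\<^sup>2)"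
proof -
  obtain x where x: "x \<in> A" "p x = m" and rest: "(\<Sum>y\<in>A - {x}. p y) = 1 - m"
    unfolding m_def by (rule obtain_Max_mass)
  have cK: "real (card (A - {x})) = K"
    using x finite card by (auto simp: K_def of_nat_diff Suc_leI)
  have K: "K > 0" using card by (simp add: K_def)
  define w where "w = (1 - m) / sqrt K"
  have "(1 - m)\<^sup>2 \<le> K * (\<Sum>y\<in>A - {x}. (p y)\<^sup>2)"
    using sum_squared_le_sum_of_squares[of p "A - {x}"] cK rest by (simp add: mult.commute)
  then have w2: "w\<^sup>2 \<le> (\<Sum>y\<in>A - {x}. (p y)\<^sup>2)"
    using K by (simp add: w_def power_divide pos_divide_le_eq mult.commute)
  \<comment> \<open>Lagrange's identity, that is, Cauchy-Schwarz in the plane for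
    \<open>(c, d)\<close> and \<open>(m, w)\<close>; the subtracted square is the loss.\<close>
  have "(c * m + d * w)\<^sup>2 = (c\<^sup>2 + d\<^sup>2) * (m\<^sup>2 + w\<^sup>2) - (c * w - d * m)\<^sup>2"
    by (simp add: power2_eq_square algebra_simps)
  also have "\<dots> \<le> m\<^sup>2 + w\<^sup>2" using cd by simp
  also have "\<dots> \<le> m\<^sup>2 + (\<Sum>y\<in>A - {x}. (p y)\<^sup>2)" using w2 by simp
  also have "\<dots> = (\<Sum>x\<in>A. (p x)\<^sup>2)"
    using sum.remove[OF finite x(1), of "\<lambda>x. (p x)\<^sup>2"] x(2) by simp
  finally show ?thesis unfolding w_def by (rule real_le_rsqrt)
qed

end

section \<open>Random probability vectors\<close>

text \<open>The infimum of \<open>t * a + b / t\<close> over \<open>t > 0\<close> is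
  \<open>2 * (sqrt a * sqrt b)\<close>, with optimal slope \<open>sqrt b / sqrt a\<close>. If
  exactly one of \<open>a\<close>, \<open>b\<close> vanishes, no positive slope attains it.\<close>

lemma le_two_sqrt_mult_if_tangents:
  fixes x a b :: real
  assumes "a \<ge> 0" "b \<ge> 0" and le: "\<And>t. t > 0 \<Longrightarrow> x \<le> t * a + b / t"
  shows "x \<le> 2 * (sqrt a * sqrt b)"
proof -
  \<comment> \<open>The optimal slope, with both roots shifted by \<open>e > 0\<close> to keep it
    finite and positive; \<open>e\<close> then tends to 0 from the right.\<close>
  define s where "s e = (sqrt b + e) / (sqrt a + e)" for e :: real
  have "x \<le> (sqrt b + e) * sqrt a + (sqrt a + e) * sqrt b" if e: "e > 0" for e
  proof -
    have pos: "sqrt a + e > 0" "sqrt b + e > 0" using assms e by (auto intro: add_nonneg_pos)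
    have sa: "a / (sqrt a + e) \<le> sqrt a"
      using pos assms e by (simp add: pos_divide_le_eq algebra_simps)
    have sb: "b / (sqrt b + e) \<le> sqrt b"
      using pos assms e by (simp add: pos_divide_le_eq algebra_simps)
    have "x \<le> s e * a + b / s e" using pos by (intro le) (simp add: s_def)
    also have "\<dots> = (sqrt b + e) * (a / (sqrt a + e)) + (sqrt a + e) * (b / (sqrt b + e))"
      by (simp add: s_def)
    also have "\<dots> \<le> (sqrt b + e) * sqrt a + (sqrt a + e) * sqrt b"
      using pos sa sb by (intro add_mono mult_left_mono) auto
    finally show ?thesis .
  qed
  then have "\<forall>\<^sub>F e in at_right 0. x \<le> (sqrt b + e) * sqrt a + (sqrt a + e) * sqrt b"
    by (auto intro: eventually_at_right_less[THEN eventually_mono])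
  moreover have "((\<lambda>e. (sqrt b + e) * sqrt a + (sqrt a + e) * sqrt b)
      \<longlongrightarrow> (sqrt b + 0) * sqrt a + (sqrt a + 0) * sqrt b) (at_right 0)"
    by (intro tendsto_intros)
  ultimately have "x \<le> (sqrt b + 0) * sqrt a + (sqrt a + 0) * sqrt b"
    by (intro tendsto_lowerbound) auto
  then show ?thesis by simp
qed

context prob_space
begin

context
  fixes A :: "'i set" and p :: "'i \<Rightarrow> 'a \<Rightarrow> real"
  assumes finite: "finite A" and card: "card A \<ge> 2"
    and meas [measurable]: "\<And>x. p x \<in> borel_measurable M"
    and nonneg: "\<And>x y. p x y \<ge> 0" and sum_1: "AE y in M. (\<Sum>x\<in>A. p x y) = 1"
begin

lemma nonempty_alphabet: "A \<noteq> {}"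
  using card by auto

lemma integrable_Max_mass: "integrable M (\<lambda>y. MAX x\<in>A. p x y)"
proof (rule integrable_const_bound[where B = 1])
  show "AE y in M. norm (MAX x\<in>A. p x y) \<le> 1"
    using sum_1
    by eventually_elim
      (simp add: Max_mass_bounds[OF finite nonempty_alphabet nonneg])
  show "(\<lambda>y. MAX x\<in>A. p x y) \<in> borel_measurable M"
    using finite nonempty_alphabet by (intro borel_measurable_Max) auto
qed

lemma integrable_sum_sqrt: "integrable M (\<lambda>y. (\<Sum>x\<in>A. sqrt (p x y))\<^sup>2)"
proof (rule integrable_const_bound[where B = "real (card A)"])
  show "AE y in M. norm ((\<Sum>x\<in>A. sqrt (p x y))\<^sup>2) \<le> real (card A)"
    using sum_1
    by eventually_elim
      (simp add: sum_sqrt_mass_squared_le_card[OF finite nonempty_alphabet nonneg])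
qed measurable

lemma integrable_norm_mass: "integrable M (\<lambda>y. sqrt (\<Sum>x\<in>A. (p x y)\<^sup>2))"
proof (rule integrable_const_bound[where B = 1])
  show "AE y in M. norm (sqrt (\<Sum>x\<in>A. (p x y)\<^sup>2)) \<le> 1"
    using sum_1
    by eventually_elim
      (simp add: sum_squared_mass_le_1[OF finite nonempty_alphabet nonneg] sum_nonneg)
qed measurable

lemma expectation_Max_mass_bounds:
  "0 \<le> expectation (\<lambda>y. MAX x\<in>A. p x y)" "expectation (\<lambda>y. MAX x\<in>A. p x y) \<le> 1"
proof -
  have *: "AE y in M. 0 \<le> (MAX x\<in>A. p x y) \<and> (MAX x\<in>A. p x y) \<le> 1"
    using sum_1
    by eventually_elim (simp add: Max_mass_bounds[OF finite nonempty_alphabet nonneg])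
  show "0 \<le> expectation (\<lambda>y. MAX x\<in>A. p x y)"
    by (rule integral_nonneg_AE) (use * in auto)
  show "expectation (\<lambda>y. MAX x\<in>A. p x y) \<le> 1"
    by (rule integral_le_const[OF integrable_Max_mass]) (use * in auto)
qed

text \<open>For \<open>\<xi>1\<close>, which is the alphabet size divided by this expectation, the
  bounds say that \<open>\<xi>1\<close> lies between 1 and that size.\<close>

lemma expectation_sum_sqrt_bounds:
  "1 \<le> expectation (\<lambda>y. (\<Sum>x\<in>A. sqrt (p x y))\<^sup>2)"
  "expectation (\<lambda>y. (\<Sum>x\<in>A. sqrt (p x y))\<^sup>2) \<le> real (card A)"
proof -
  show "1 \<le> expectation (\<lambda>y. (\<Sum>x\<in>A. sqrt (p x y))\<^sup>2)"
  proof (rule integral_ge_const[OF integrable_sum_sqrt])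
    show "AE y in M. 1 \<le> (\<Sum>x\<in>A. sqrt (p x y))\<^sup>2"
      using sum_1
      by eventually_elim
        (simp add: sum_sqrt_mass_ge_1[OF finite nonempty_alphabet nonneg] one_le_power)
  qed
  show "expectation (\<lambda>y. (\<Sum>x\<in>A. sqrt (p x y))\<^sup>2) \<le> real (card A)"
  proof (rule integral_le_const[OF integrable_sum_sqrt])
    show "AE y in M. (\<Sum>x\<in>A. sqrt (p x y))\<^sup>2 \<le> real (card A)"
      using sum_1
      by eventually_elim
        (simp add: sum_sqrt_mass_squared_le_card[OF finite nonempty_alphabet nonneg])
  qed
qed

text \<open>For fixed \<open>t\<close> the pointwise bound is affine in the maximal mass, so its
  expectation depends on \<open>\<mu>\<close> only. Optimising over \<open>t\<close> after
  integrating replaces Jensen's inequality.\<close>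

lemma expectation_sum_sqrt_le:
  defines "\<mu> \<equiv> expectation (\<lambda>y. MAX x\<in>A. p x y)" and "K \<equiv> real (card A) - 1"
  shows "expectation (\<lambda>y. (\<Sum>x\<in>A. sqrt (p x y))\<^sup>2) \<le> (sqrt \<mu> + sqrt (K * (1 - \<mu>)))\<^sup>2"
proof -
  let ?S = "expectation (\<lambda>y. (\<Sum>x\<in>A. sqrt (p x y))\<^sup>2)"
  have K: "K > 0" using card by (simp add: K_def)
  have \<mu>: "0 \<le> \<mu>" "\<mu> \<le> 1" using expectation_Max_mass_bounds by (auto simp: \<mu>_def)
  have bound: "?S \<le> \<mu> + K * (1 - \<mu>) + sqrt K * (t * \<mu> + (1 - \<mu>) / t)"
    if t: "t > 0" for t
  proof -
    have "?S \<le> expectation (\<lambda>y. (MAX x\<in>A. p x y) + K * (1 - (MAX x\<in>A. p x y)) +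
        sqrt K * (t * (MAX x\<in>A. p x y) + (1 - (MAX x\<in>A. p x y)) / t))"
    proof (rule integral_mono_AE[OF integrable_sum_sqrt])
      show "AE y in M. (\<Sum>x\<in>A. sqrt (p x y))\<^sup>2 \<le>
          (MAX x\<in>A. p x y) + K * (1 - (MAX x\<in>A. p x y)) +
          sqrt K * (t * (MAX x\<in>A. p x y) + (1 - (MAX x\<in>A. p x y)) / t)"
        using sum_1 unfolding K_def
        by eventually_elim
          (rule sum_sqrt_mass_squared_le[OF finite nonempty_alphabet nonneg _ t])
    qed (intro Bochner_Integration.integrable_add Bochner_Integration.integrable_diff
        integrable_mult_right integrable_divide integrable_const integrable_Max_mass)
    also have "\<dots> = \<mu> + K * (1 - \<mu>) + sqrt K * (t * \<mu> + (1 - \<mu>) / t)"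
      using integrable_Max_mass by (simp add: \<mu>_def prob_space)
    finally show ?thesis .
  qed
  \<comment> \<open>The terms depending on \<open>t\<close> are isolated, to optimise over
    \<open>t\<close> with \<open>a = \<mu>\<close> and \<open>b = 1 - \<mu>\<close>.\<close>
  have "?S - \<mu> - K * (1 - \<mu>) \<le> sqrt K * (t * \<mu> + (1 - \<mu>) / t)" if "t > 0" for t
    using that[THEN bound] by linarith
  then have "(?S - \<mu> - K * (1 - \<mu>)) / sqrt K \<le> t * \<mu> + (1 - \<mu>) / t" if "t > 0" for t
    using K that by (simp only: pos_divide_le_eq real_sqrt_gt_zero mult.commute[of _ "sqrt K"])
  then have "(?S - \<mu> - K * (1 - \<mu>)) / sqrt K \<le> 2 * (sqrt \<mu> * sqrt (1 - \<mu>))"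
    using \<mu> by (intro le_two_sqrt_mult_if_tangents) auto
  then have "?S \<le> \<mu> + K * (1 - \<mu>) + 2 * (sqrt \<mu> * sqrt (1 - \<mu>)) * sqrt K"
    using K by (simp add: pos_divide_le_eq)
  also have "\<dots> = (sqrt \<mu> + sqrt (K * (1 - \<mu>)))\<^sup>2"
    using \<mu> K by (simp add: power2_sum real_sqrt_mult power_mult_distrib)
  finally show ?thesis .
qed

text \<open>The pointwise bound is integrated for a fixed unit vector \<open>(c, d)\<close>; only
  then is \<open>(c, d)\<close> taken along \<open>(\<mu>, w)\<close>, where the pairing equals the
  norm \<open>r\<close>.\<close>

lemma expectation_norm_mass_ge:
  defines "\<mu> \<equiv> expectation (\<lambda>y. MAX x\<in>A. p x y)" and "K \<equiv> real (card A) - 1"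
  shows "\<mu>\<^sup>2 + (1 - \<mu>)\<^sup>2 / K \<le> (expectation (\<lambda>y. sqrt (\<Sum>x\<in>A. (p x y)\<^sup>2)))\<^sup>2"
proof -
  let ?T = "expectation (\<lambda>y. sqrt (\<Sum>x\<in>A. (p x y)\<^sup>2))"
  have K: "K > 0" using card by (simp add: K_def)
  have T: "c * \<mu> + d * ((1 - \<mu>) / sqrt K) \<le> ?T" if cd: "c\<^sup>2 + d\<^sup>2 = 1" for c d
  proof -
    have "c * \<mu> + d * ((1 - \<mu>) / sqrt K) =
        expectation (\<lambda>y. c * (MAX x\<in>A. p x y) + d * ((1 - (MAX x\<in>A. p x y)) / sqrt K))"
      using integrable_Max_mass by (simp add: \<mu>_def prob_space)
    also have "\<dots> \<le> ?T"
    proof (rule integral_mono_AE[OF _ integrable_norm_mass])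
      show "AE y in M. c * (MAX x\<in>A. p x y) + d * ((1 - (MAX x\<in>A. p x y)) / sqrt K)
          \<le> sqrt (\<Sum>x\<in>A. (p x y)\<^sup>2)"
        using sum_1 unfolding K_def
        by eventually_elim
          (rule norm_mass_ge[OF finite nonempty_alphabet nonneg _ cd card])
    qed (intro Bochner_Integration.integrable_add Bochner_Integration.integrable_diff
        integrable_mult_right integrable_divide integrable_const integrable_Max_mass)
    finally show ?thesis .
  qed
  define w where "w = (1 - \<mu>) / sqrt K"
  define r where "r = sqrt (\<mu>\<^sup>2 + w\<^sup>2)"
  have r2: "r\<^sup>2 = \<mu>\<^sup>2 + w\<^sup>2" by (simp add: r_def)
  have "r > 0"
  proof -
    \<comment> \<open>If \<open>\<mu> = 0\<close> then \<open>w = 1 / sqrt K\<close>, so normalising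
      by \<open>r\<close> is legitimate.\<close>
    have "\<mu> \<noteq> 0 \<or> w \<noteq> 0" using K by (auto simp: w_def)
    then show ?thesis unfolding r_def real_sqrt_gt_0_iff sum_power2_gt_zero_iff .
  qed
  moreover have "(\<mu> / r)\<^sup>2 + (w / r)\<^sup>2 = r\<^sup>2 / r\<^sup>2"
    by (simp only: r2 power_divide add_divide_distrib)
  with \<open>r > 0\<close> have "(\<mu> / r)\<^sup>2 + (w / r)\<^sup>2 = 1" by simp
  then have "\<mu> / r * \<mu> + w / r * w \<le> ?T" unfolding w_def by (rule T)
  moreover have "\<mu> / r * \<mu> + w / r * w = r\<^sup>2 / r"
    unfolding r2 by (simp add: power2_eq_square add_divide_distrib)
  ultimately have "r \<le> ?T" "0 \<le> r" by (auto simp: power2_eq_square)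
  then have "r\<^sup>2 \<le> ?T\<^sup>2" by (rule power_mono)
  then show ?thesis using K by (simp add: r2 w_def power_divide)
qed

end

end

section \<open>The posterior\<close>

text \<open>Over any \<open>B\<close> the sum integrates to the probability of \<open>Y\<close>
  lying in \<open>B\<close>, since the events \<open>X = x\<close> partition the space. Uniqueness
  of densities then identifies it with 1 almost everywhere.\<close>

lemma AE_sum_posterior:
  assumes P: "prob_space P" and A: "finite A"
    and X: "X \<in> measurable P (count_space A)" and Y: "Y \<in> measurable P N"
  shows "AE y in distr P N Y. (\<Sum>x\<in>A. posterior P X N Y x y) = 1"
proof -
  note Y[measurable] borel_measurable_posterior[OF P A X Y, measurable]
  interpret P: prob_space P by (rule P)
  let ?D = "distr P N Y" and ?p = "posterior P X N Y"
  interpret D: prob_space ?D by (rule P.prob_space_distr[OF Y])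
  have p0: "?p x y \<ge> 0" for x y by (simp add: posterior_def)
  have "(\<integral>\<^sup>+y\<in>B. ennreal (\<Sum>x\<in>A. ?p x y) \<partial>?D) = (\<integral>\<^sup>+y\<in>B. 1 \<partial>?D)" if B: "B \<in> sets N" for B
  proof -
    note B[measurable]
    have XE: "{\<omega> \<in> space P. X \<omega> = x \<and> Y \<omega> \<in> B} \<in> sets P" if "x \<in> A" for x
    proof -
      have "X -` {x} \<inter> space P \<in> sets P" "Y -` B \<inter> space P \<in> sets P"
        using measurable_sets[OF X, of "{x}"] measurable_sets[OF Y B] that by auto
      then have "(X -` {x} \<inter> space P) \<inter> (Y -` B \<inter> space P) \<in> sets P" by blast
      then show ?thesis by (rule back_subst[where P = "\<lambda>S. S \<in> sets P"]) auto
    qed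
    have "(\<integral>\<^sup>+y\<in>B. ennreal (\<Sum>x\<in>A. ?p x y) \<partial>?D) =
        (\<integral>\<^sup>+y. (\<Sum>x\<in>A. ennreal (?p x y) * indicator B y) \<partial>?D)"
      by (simp add: p0 sum_distrib_right flip: sum_ennreal)
    also have "\<dots> = (\<Sum>x\<in>A. \<integral>\<^sup>+y\<in>B. ennreal (?p x y) \<partial>?D)"
      by (rule nn_integral_sum) measurable
    also have "\<dots> = (\<Sum>x\<in>A. emeasure P {\<omega> \<in> space P. X \<omega> = x \<and> Y \<omega> \<in> B})"
      by (intro sum.cong refl)
        (simp add: set_nn_integral_posterior[OF P A X Y _ B] P.emeasure_eq_measure)
    also have "\<dots> = emeasure P (\<Union>x\<in>A. {\<omega> \<in> space P. X \<omega> = x \<and> Y \<omega> \<in> B})"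
      by (rule sum_emeasure) (use A XE in \<open>auto simp: disjoint_family_on_def\<close>)
    also have "(\<Union>x\<in>A. {\<omega> \<in> space P. X \<omega> = x \<and> Y \<omega> \<in> B}) = Y -` B \<inter> space P"
      using measurable_space[OF X] by auto
    also have "emeasure P \<dots> = emeasure ?D B" by (simp add: emeasure_distr)
    finally show ?thesis using B by simp
  qed
  then have "density ?D (\<lambda>y. ennreal (\<Sum>x\<in>A. ?p x y)) = density ?D (\<lambda>_. 1)"
    by (intro measure_eqI) (auto simp: emeasure_density)
  then have "AE y in ?D. ennreal (\<Sum>x\<in>A. ?p x y) = 1"
    by (subst (asm) D.density_unique_iff) auto
  then show ?thesis by eventually_elim simp
qed

section \<open>Solving for the error probability\<close>

text \<open>Here \<open>s\<close> stands for \<open>m / \<xi>1\<close>. The left-hand side is the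
  square of \<open>(r * sqrt s - sqrt (m - s)) / m\<close>, where \<open>r = sqrt (m - 1)\<close>,
  and this quotient is a lower bound for \<open>sqrt \<epsilon>\<close>.\<close>

lemma sqrt_bound_solved:
  fixes \<epsilon> s m :: real
  assumes m: "m > 1" and s: "1 \<le> s" "s \<le> m" and \<epsilon>: "0 \<le> \<epsilon>" "\<epsilon> \<le> 1"
    and le: "s \<le> (sqrt (1 - \<epsilon>) + sqrt ((m - 1) * \<epsilon>))\<^sup>2"
  shows "(1 - 1 / m) * (1 / (m / s)) * (1 - sqrt ((m / s - 1) / (m - 1)))\<^sup>2 \<le> \<epsilon>"
proof -
  define r where "r = sqrt (m - 1)"
  define e f where "e = sqrt \<epsilon>" and "f = sqrt (1 - \<epsilon>)"
  have r: "r > 0" "r\<^sup>2 = m - 1" using m by (auto simp: r_def)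
  have ef: "e\<^sup>2 = \<epsilon>" "f\<^sup>2 = 1 - \<epsilon>" "e \<ge> 0" "f \<ge> 0" using \<epsilon> by (auto simp: e_def f_def)
  have su: "s \<le> (f + r * e)\<^sup>2" using le by (simp add: r_def e_def f_def real_sqrt_mult)
  have "sqrt s \<le> f + r * e" using real_sqrt_le_mono[OF su] ef r by simp
  then have u: "r * sqrt s \<le> r * (f + r * e)" using r by simp
  \<comment> \<open>Rotating \<open>(f, e)\<close> by the angle with tangent \<open>r\<close> gives \<open>(f + r e, r f - e)\<close>, up to the
    factor \<open>\<surd>m\<close>.\<close>
  have "(f + r * e)\<^sup>2 + (r * f - e)\<^sup>2 = (1 + r\<^sup>2) * (e\<^sup>2 + f\<^sup>2)"
    by (simp add: power2_eq_square algebra_simps)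
  also have "\<dots> = m" using r ef by simp
  finally have "(r * f - e)\<^sup>2 \<le> m - s" using su by simp
  then have v: "r * f - e \<le> sqrt (m - s)" by (rule real_le_rsqrt)
  have "r * (f + r * e) - (r * f - e) = (1 + r\<^sup>2) * e"
    by (simp add: power2_eq_square algebra_simps)
  also have "\<dots> = m * e" using r by simp
  finally have main: "r * sqrt s - sqrt (m - s) \<le> m * e" using u v by linarith
  \<comment> \<open>\<open>s \<ge> 1\<close> makes the lower bound for \<open>m * e\<close>
    nonnegative, which is needed before squaring it.\<close>
  have "m * 1 \<le> m * s" using m s by (intro mult_left_mono) auto
  then have "m - s \<le> (m - 1) * s" by (simp add: algebra_simps)
  then have pos: "sqrt (m - s) \<le> r * sqrt s"
    unfolding r_def by (subst real_sqrt_mult[symmetric]) simp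
  have "sqrt ((m / s - 1) / (m - 1)) = sqrt (m - s) / (r * sqrt s)"
    using m s by (simp add: r_def flip: real_sqrt_mult real_sqrt_divide)
      (simp add: field_simps)
  then have "1 - sqrt ((m / s - 1) / (m - 1)) = (r * sqrt s - sqrt (m - s)) / (r * sqrt s)"
    using r s by (simp add: diff_divide_distrib)
  moreover have "(1 - 1 / m) * (1 / (m / s)) = (r * sqrt s)\<^sup>2 / m\<^sup>2"
  proof -
    have "1 - 1 / m = (m - 1) / m" using m by (simp add: diff_divide_distrib)
    then show ?thesis using s r by (simp add: power_mult_distrib power2_eq_square[of m])
  qed
  ultimately have "(1 - 1 / m) * (1 / (m / s)) * (1 - sqrt ((m / s - 1) / (m - 1)))\<^sup>2 =
      (r * sqrt s)\<^sup>2 / m\<^sup>2 * ((r * sqrt s - sqrt (m - s)) / (r * sqrt s))\<^sup>2"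
    by simp
  also have "\<dots> = ((r * sqrt s - sqrt (m - s)) / m)\<^sup>2"
    using r s by (simp add: power_divide)
  also have "\<dots> \<le> e\<^sup>2"
    using main pos m by (intro power_mono) (simp_all add: pos_divide_le_eq mult.commute)
  finally show ?thesis using ef by simp
qed

text \<open>In units of \<open>1 - 1 / m\<close>, the error of guessing among \<open>m\<close>
  equally likely values, the quadratic minus 1 is the perfect square
  \<open>(m - 1) * (1 - \<theta>)\<^sup>2\<close>.\<close>

lemma quadratic_bound_solved:
  fixes \<epsilon> \<xi> m :: real
  assumes m: "m > 1" and le: "m * ((1 - \<epsilon>)\<^sup>2 + \<epsilon>\<^sup>2 / (m - 1)) \<le> \<xi>"
  shows "(1 - 1 / m) * (1 - sqrt ((\<xi> - 1) / (m - 1))) \<le> \<epsilon>"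
proof -
  define \<theta> where "\<theta> = \<epsilon> * m / (m - 1)"
  have \<epsilon>: "\<epsilon> = (1 - 1 / m) * \<theta>" using m by (simp add: \<theta>_def field_simps)
  have "m * ((1 - \<epsilon>)\<^sup>2 + \<epsilon>\<^sup>2 / (m - 1)) - 1 = (m - 1) * (1 - \<theta>)\<^sup>2"
    using m unfolding \<theta>_def by (simp add: field_simps) (simp add: power2_eq_square algebra_simps)
  then have "(1 - \<theta>)\<^sup>2 \<le> (\<xi> - 1) / (m - 1)"
    using le m by (simp add: pos_le_divide_eq mult.commute)
  then have "1 - \<theta> \<le> sqrt ((\<xi> - 1) / (m - 1))" by (rule real_le_rsqrt)
  then have "(1 - 1 / m) * (1 - sqrt ((\<xi> - 1) / (m - 1))) \<le> (1 - 1 / m) * \<theta>"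
    using m by (intro mult_left_mono) auto
  then show ?thesis using \<epsilon> by simp
qed

theorem theorem5:
  fixes P :: "'w measure" and A :: "'a set" and X :: "'w \<Rightarrow> 'a"
    and N :: "'b measure" and Y :: "'w \<Rightarrow> 'b" and b :: real and M :: nat and \<xi>1 \<xi>2 :: real
  assumes "b > 1"
    and "prob_space P"
    and "finite A" and "card A = M" and "M \<ge> 2"
    and "X \<in> measurable P (count_space A)"
    and "Y \<in> measurable P N"
    and "\<xi>1 = real M * b powr (- arimoto_renyi b (1/2) P A X N Y)"
    and "\<xi>2 = real M * b powr (- arimoto_renyi b 2 P A X N Y)"
  shows "min_error_prob P A X N Y \<ge>
           (1 - 1 / real M) * (1 / \<xi>1) * (1 - sqrt ((\<xi>1 - 1) / (real M - 1)))\<^sup>2 \<and>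
         min_error_prob P A X N Y \<ge>
           (1 - 1 / real M) * (1 - sqrt ((\<xi>2 - 1) / (real M - 1)))"
proof -
  note b = \<open>b > 1\<close> and PAXY = assms(2,3,6,7)
  have M: "card A \<ge> 2" "real M > 1" and ne: "A \<noteq> {}" using assms(4,5) by auto
  interpret P: prob_space P by fact
  let ?D = "distr P N Y" and ?p = "posterior P X N Y"
  interpret D: prob_space ?D by (rule P.prob_space_distr) fact
  have meas: "?p x \<in> borel_measurable ?D" for x
    using borel_measurable_posterior[OF PAXY] by simp
  have p0: "?p x y \<ge> 0" for x y by (simp add: posterior_def)
  note D = \<open>finite A\<close> M(1) meas p0 AE_sum_posterior[OF PAXY]

  define S where "S = (\<integral>y. (\<Sum>x\<in>A. sqrt (?p x y))\<^sup>2 \<partial>?D)"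
  define T where "T = (\<integral>y. sqrt (\<Sum>x\<in>A. (?p x y)\<^sup>2) \<partial>?D)"
  define \<mu> where "\<mu> = (\<integral>y. (MAX x\<in>A. ?p x y) \<partial>?D)"
  have err: "min_error_prob P A X N Y = 1 - \<mu>"
    unfolding \<mu>_def by (rule min_error_prob_attained(2)[OF PAXY ne])
  have \<mu>: "0 \<le> \<mu>" "\<mu> \<le> 1"
    unfolding \<mu>_def by (rule D.expectation_Max_mass_bounds[OF D])+
  have S: "1 \<le> S" "S \<le> real M" "S \<le> (sqrt \<mu> + sqrt ((real M - 1) * (1 - \<mu>)))\<^sup>2"
    using D.expectation_sum_sqrt_bounds[OF D] D.expectation_sum_sqrt_le[OF D]
    by (simp_all add: S_def \<mu>_def assms(4))
  have T2: "\<mu>\<^sup>2 + (1 - \<mu>)\<^sup>2 / (real M - 1) \<le> T\<^sup>2"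
    using D.expectation_norm_mass_ge[OF D] by (simp add: T_def \<mu>_def assms(4))
  \<comment> \<open>Positivity of \<open>T\<close> lets the exponential cancel the logarithm in
    \<open>\<xi>2\<close>.\<close>
  have "T \<noteq> 0"
  proof
    assume "T = 0"
    then have "\<mu>\<^sup>2 + (1 - \<mu>)\<^sup>2 / (real M - 1) \<le> 0" using T2 by simp
    moreover have "(1 - \<mu>)\<^sup>2 / (real M - 1) \<ge> 0" "\<mu>\<^sup>2 \<ge> 0" using M by simp_all
    ultimately have "\<mu>\<^sup>2 = 0" "(1 - \<mu>)\<^sup>2 / (real M - 1) = 0" by linarith+
    then show False using M by simp
  qed
  moreover have "T \<ge> 0" unfolding T_def by (simp add: sum_nonneg)
  ultimately have T0: "T > 0" by simp

  \<comment> \<open>At order 1/2 the prefactor is 1 and the outer exponent 2; at order 2 they are -2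
    and 1/2.\<close>
  have "(\<integral>y. (\<Sum>x\<in>A. ?p x y powr (1/2)) powr (1 / (1/2)) \<partial>?D) = S"
    unfolding S_def by (simp add: powr_half_sqrt p0 sum_nonneg)
  then have "arimoto_renyi b (1/2) P A X N Y = log b S" by (simp add: arimoto_renyi_def)
  then have \<xi>1: "\<xi>1 = real M / S"
    using S b by (simp add: assms(8) powr_minus_divide)
  have "(\<integral>y. (\<Sum>x\<in>A. ?p x y powr 2) powr (1 / 2) \<partial>?D) = T"
    unfolding T_def by (simp add: powr_half_sqrt p0 sum_nonneg)
  then have "arimoto_renyi b 2 P A X N Y = - (2 * log b T)" by (simp add: arimoto_renyi_def)
  also have "2 * log b T = log b (T\<^sup>2)" using T0 by (simp add: log_nat_power)
  finally have \<xi>2: "\<xi>2 = real M * T\<^sup>2"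
    using T0 b by (simp add: assms(9))

  \<comment> \<open>Both inequalities are solved with \<open>\<epsilon> = 1 - \<mu>\<close>, the
    first with \<open>s = S\<close>.\<close>
  show ?thesis
    unfolding err \<xi>1
  proof
    show "(1 - 1 / real M) * (1 / (real M / S)) *
        (1 - sqrt ((real M / S - 1) / (real M - 1)))\<^sup>2 \<le> 1 - \<mu>"
      using M S \<mu> by (intro sqrt_bound_solved) auto
    show "(1 - 1 / real M) * (1 - sqrt ((\<xi>2 - 1) / (real M - 1))) \<le> 1 - \<mu>"
      using M T2 by (intro quadratic_bound_solved) (auto simp: \<xi>2)
  qed
qed

end
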